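(* Let $(X,\tau,\le)$ be a separable linearly ordered topological space, let $\mu$ be a probability measure on the Borel $\sigma$-algebra of $(X,\tau)$, let $F$ be its cumulative distribution function and let $G$ be the pseudo-inverse of $F$. Then $G$ is left $\tau$-continuous.
   Context: A linearly ordered topological space (LOTS) is a triple $(X,\tau,\le)$ where $\le$ is a linear order on $X$ and $\tau$ is the order topology, i.e. the topology with subbasis $\{\{x\in X:x<a\}:a\in X\}\cup\{\{x\in X:x>a\}:a\in X\}$. Separable means having a countable $\tau$-dense subset. The cumulative distribution function of $\mu$ is $F:X\to[0,1]$, $F(x)=\mu(\{y\in X:y\le x\})$. The pseudo-inverse of $F$ is the partial function $G$ from $[0,1]$ to $X$ given by $G(r)=\inf\{y\in X:F(y)\ge r\}$, defined exactly on the set $A$ of those $r\in[0,1]$ for which this infimum (greatest lower bound in $X$) exists. $G$ is left $\tau$-continuous means: for every $r\in A$ and every sequence $(r_n)$ in $A$ with $r_n\le r$ for all $n$ and $r_n\to r$ (in the Euclidean topology), $G(r_n)\to G(r)$ in $\tau$. *)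

theory Defs
  imports "HOL-Probability.Probability" "HOL-Library.Lub_Glb"
begin

(* The library's cdf is restricted to measures on the reals. *)
definition lots_cdf :: "'a::linorder_topology measure \<Rightarrow> 'a \<Rightarrow> real"
  where "lots_cdf M x = measure M {y. y \<le> x}"

(* The pseudo-inverse is a partial function, encoded as its domain together with a total
   function whose values outside the domain are unspecified.  The infimum is the greatest lower
   bound in the order of 'a, which need not be complete.  It may also be taken of the empty set,
   whose infimum exists iff 'a has a greatest element. *)
definition pseudo_inverse_dom :: "'a::linorder_topology measure \<Rightarrow> real set"
  where "pseudo_inverse_dom M = {r \<in> {0..1}. \<exists>g. isGlb UNIV {y. lots_cdf M y \<ge> r} g}"

definition pseudo_inverse :: "'a::linorder_topology measure \<Rightarrow> real \<Rightarrow> 'a"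
  where "pseudo_inverse M r = (THE g. isGlb UNIV {y. lots_cdf M y \<ge> r} g)"

definition left_continuous_on :: "real set \<Rightarrow> (real \<Rightarrow> 'a::topological_space) \<Rightarrow> bool"
  where "left_continuous_on A G \<longleftrightarrow>
    (\<forall>r\<in>A. \<forall>s :: nat \<Rightarrow> real.
      (\<forall>n. s n \<in> A \<and> s n \<le> r) \<longrightarrow> s \<longlonglongrightarrow> r \<longrightarrow> (\<lambda>n. G (s n)) \<longlonglongrightarrow> G r)"

end

theory Submission
  imports Defs
begin

text \<open>
  The heart of the matter is that the infimum \<open>g\<close> of a nonempty superlevel set \<open>{y. r \<le> F y}\<close>
  belongs to that set whenever it exists (\<open>le_cdf_isGlb\<close>). For if it did not, \<open>g\<close> would be a
  limit of points of the set from the right; separability then makes \<open>{..g}\<close> a countable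
  decreasing intersection of rays \<open>{..e}\<close> with \<open>F e \<ge> r\<close>, and continuity of the measure from
  above gives \<open>F g \<ge> r\<close>.

  Left continuity follows from the relation between \<open>F\<close> and \<open>G\<close>. Since \<open>G\<close> is
  monotone, only the lower rays at \<open>G r\<close> matter. If \<open>a < G r\<close>, then \<open>F a < r\<close>, so
  \<open>F a < s n\<close> for almost all \<open>n\<close>; as \<open>s n \<le> F (G (s n))\<close>, this forces \<open>a < G (s n)\<close>. If \<open>s n\<close>
  exceeds every value of \<open>F\<close>, then \<open>G (s n)\<close> is the infimum of the empty set, that is, the
  greatest element, and \<open>a < G (s n)\<close> again.
\<close>

lemma isGlb_UNIV_iff:
  fixes g :: "'a::linorder"
  shows "isGlb UNIV S g \<longleftrightarrow> (\<forall>x\<in>S. g \<le> x) \<and> (\<forall>b. (\<forall>x\<in>S. b \<le> x) \<longrightarrow> b \<le> g)"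
  by (auto simp: isGlb_def greatestP_def isLb_def setge_def setle_def)

lemma isGlb_pseudo_inverse:
  assumes "r \<in> pseudo_inverse_dom M"
  shows "isGlb UNIV {y. r \<le> lots_cdf M y} (pseudo_inverse M r)"
proof -
  obtain g where g: "isGlb UNIV {y. r \<le> lots_cdf M y} g"
    using assms by (auto simp: pseudo_inverse_dom_def)
  show ?thesis
    unfolding pseudo_inverse_def
  proof (rule theI[where a = g])
    show "isGlb UNIV {y. r \<le> lots_cdf M y} g" by (fact g)
    show "h = g" if "isGlb UNIV {y. r \<le> lots_cdf M y} h" for h
      using that g unfolding isGlb_UNIV_iff by (intro antisym) simp_all
  qed
qed

lemma pseudo_inverse_mono:
  assumes "r \<in> pseudo_inverse_dom M" "s \<in> pseudo_inverse_dom M" "r \<le> s"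
  shows "pseudo_inverse M r \<le> pseudo_inverse M s"
  using isGlb_pseudo_inverse[OF assms(1)] isGlb_pseudo_inverse[OF assms(2)] \<open>r \<le> s\<close>
  by (force simp: isGlb_UNIV_iff)

lemma lots_cdf_mono:
  fixes M :: "'a::linorder_topology measure"
  assumes "prob_space M" "sets M = sets borel" "x \<le> y"
  shows "lots_cdf M x \<le> lots_cdf M y"
proof -
  interpret prob_space M by fact
  have "{..y} \<in> sets M" by (simp add: assms(2))
  then show ?thesis
    using \<open>x \<le> y\<close> unfolding lots_cdf_def atMost_def by (intro finite_measure_mono) auto
qed

text \<open>
  This is right continuity of the distribution function at \<open>g\<close>. If \<open>g\<close> were not attained, it
  would have no immediate successor, so every interval \<open>{g<..<y}\<close> with \<open>g < y\<close> would meet a countable dense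
  set. Points of that set then descend to \<open>g\<close>, which lets continuity from above, a statement
  about sequences of sets, reach \<open>F g\<close>.
\<close>

lemma le_cdf_isGlb:
  fixes M :: "'a::linorder_topology measure"
  assumes sep: "separable_space (euclidean :: 'a topology)"
    and prob: "prob_space M" and sets: "sets M = sets borel"
    and g: "isGlb UNIV {y. r \<le> lots_cdf M y} g"
    and ne: "{y. r \<le> lots_cdf M y} \<noteq> {}"
  shows "r \<le> lots_cdf M g"
proof (rule ccontr)
  assume "\<not> r \<le> lots_cdf M g"
  then have gr: "lots_cdf M g < r" by simp
  interpret prob_space M by fact
  note mono = lots_cdf_mono[OF prob sets]
  have above: "g < z" if "r \<le> lots_cdf M z" for z
  proof (rule ccontr)
    assume "\<not> g < z"
    then have "lots_cdf M z \<le> lots_cdf M g" by (intro mono) simp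
    with that gr show False by linarith
  qed
  have approach: "\<exists>z. r \<le> lots_cdf M z \<and> g < z \<and> z < y" if "g < y" for y
  proof -
    have "\<not> (\<forall>z\<in>{y. r \<le> lots_cdf M y}. y \<le> z)"
      using g that unfolding isGlb_UNIV_iff by (meson leD)
    then show ?thesis using above by (auto simp: not_le)
  qed
  have F_ge: "r \<le> lots_cdf M y" if "g < y" for y
  proof -
    from approach[OF that] obtain z where "r \<le> lots_cdf M z" "z < y" by blast
    then show ?thesis using mono[OF less_imp_le, of z y] by linarith
  qed
  obtain D :: "'a set" where "countable D" and "closure D = UNIV"
    using sep unfolding separable_space_def by auto
  have dense: "\<exists>d\<in>D. g < d \<and> d < y" if "g < y" for y
  proof -
    have "{g<..<y} \<noteq> {}" using approach[OF that] by auto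
    then have "{g<..<y} \<inter> D \<noteq> {}"
      using open_Int_closure_eq_empty[of "{g<..<y}" D] \<open>closure D = UNIV\<close> by simp
    then show ?thesis by auto
  qed
  define e where "e = from_nat_into (D \<inter> {g<..})"
  have "D \<inter> {g<..} \<noteq> {}"
    using ne above dense by blast
  then have range_e: "range e = D \<inter> {g<..}"
    unfolding e_def using \<open>countable D\<close> by (intro range_from_nat_into) auto
  \<comment> \<open>Running minima turn the enumeration into a decreasing sequence of rays.\<close>
  define m where "m n = Min (e ` {..n})" for n
  have m_gt: "g < m n" for n
    using range_e unfolding m_def by auto
  have m_le: "m n \<le> e n" for n
    unfolding m_def by (intro Min_le) auto
  have dec: "decseq (\<lambda>n. {..m n})"
  proof (rule antimonoI)
    fix i j :: nat assume "i \<le> j"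
    then have "m j \<le> m i" unfolding m_def by (intro Min_antimono image_mono) auto
    then show "{..m j} \<subseteq> {..m i}" by simp
  qed
  have INT: "(\<Inter>n. {..m n}) = {..g}"
  proof (intro equalityI subsetI)
    fix y assume y: "y \<in> (\<Inter>n. {..m n})"
    show "y \<in> {..g}"
    proof (rule ccontr)
      assume "y \<notin> {..g}"
      then have "g < y" by (simp add: not_le)
      then obtain d where "d \<in> D" "g < d" "d < y" using dense by blast
      then obtain n where "e n = d" using range_e by (metis IntI greaterThan_iff imageE)
      then have "m n < y" using m_le[of n] \<open>d < y\<close> by (simp add: le_less_trans)
      moreover have "y \<le> m n" using y by blast
      ultimately show False by simp
    qed
  next
    fix y assume "y \<in> {..g}"
    then have "y \<le> m n" for n using less_imp_le[OF m_gt[of n]] by (auto intro: order_trans)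
    then show "y \<in> (\<Inter>n. {..m n})" by simp
  qed
  have "(\<lambda>n. measure M {..m n}) \<longlonglongrightarrow> measure M (\<Inter>n. {..m n})"
    by (intro finite_Lim_measure_decseq dec) (auto simp: sets)
  then have "(\<lambda>n. lots_cdf M (m n)) \<longlonglongrightarrow> lots_cdf M g"
    unfolding INT by (simp add: lots_cdf_def atMost_def)
  then have "r \<le> lots_cdf M g"
    by (rule LIMSEQ_le_const) (use F_ge m_gt in auto)
  with gr show False by simp
qed

theorem proposition6p7:
  fixes M :: "'a::linorder_topology measure"
  assumes "separable_space (euclidean :: 'a topology)"
    and "prob_space M"
    and "sets M = sets borel"
  shows "left_continuous_on (pseudo_inverse_dom M) (pseudo_inverse M)"
  unfolding left_continuous_on_def
proof (intro ballI allI impI)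
  fix r and s :: "nat \<Rightarrow> real"
  assume r: "r \<in> pseudo_inverse_dom M"
    and s: "\<forall>n. s n \<in> pseudo_inverse_dom M \<and> s n \<le> r" and lim: "s \<longlonglongrightarrow> r"
  let ?F = "lots_cdf M" and ?G = "pseudo_inverse M"
  have G_s: "isGlb UNIV {y. s n \<le> ?F y} (?G (s n))" for n
    using s isGlb_pseudo_inverse by blast
  show "(\<lambda>n. ?G (s n)) \<longlonglongrightarrow> ?G r"
  proof (rule order_tendstoI)
    fix a assume a: "a < ?G r"
    have "?F a < r"
    proof (rule ccontr)
      assume "\<not> ?F a < r"
      then have "?G r \<le> a"
        using isGlb_pseudo_inverse[OF r] unfolding isGlb_UNIV_iff by simp
      with a show False by simp
    qed
    then have "\<forall>\<^sub>F n in sequentially. ?F a < s n"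
      using lim by (rule order_tendstoD(1)[rotated])
    then show "\<forall>\<^sub>F n in sequentially. a < ?G (s n)"
    proof eventually_elim
      case (elim n)
      show ?case
      proof (cases "{y. s n \<le> ?F y} = {}")
        case True
        then have "?G r \<le> ?G (s n)"
          using G_s[of n] by (auto simp: isGlb_UNIV_iff)
        with a show ?thesis by simp
      next
        case False
        then have "s n \<le> ?F (?G (s n))"
          using le_cdf_isGlb[OF assms G_s] by blast
        with elim have "\<not> ?F (?G (s n)) \<le> ?F a" by simp
        then show ?thesis
          using lots_cdf_mono[OF assms(2,3)] not_le by blast
      qed
    qed
  next
    fix a assume "?G r < a"
    then have "?G (s n) < a" for n
      using pseudo_inverse_mono[OF _ r, of "s n"] s by (meson le_less_trans)
    then show "\<forall>\<^sub>F n in sequentially. ?G (s n) < a" by simp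
  qed
qed

end
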